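(* Consider the one-dimensional polytropic ($\gamma>1$) or isothermal ($\gamma=1$) Euler system, with state $\mathbf u=(\varrho,\varrho v_1,\varrho v_2,\varrho v_3)^T$, $\varrho>0$, and flux $\mathbf f(\mathbf u)=(\varrho v_1,\ \varrho v_1^2+p,\ \varrho v_1v_2,\ \varrho v_1v_3)^T$. For left and right states $\mathbf u_L,\mathbf u_R$ define the numerical flux $$\mathbf f^{*,\mathrm{EC}}(\mathbf u_L,\mathbf u_R)=\begin{bmatrix}\{\!\{\varrho\}\!\}_\gamma\{\!\{v_1\}\!\}\\ \{\!\{\varrho\}\!\}_\gamma\{\!\{v_1\}\!\}^2+\{\!\{p\}\!\}\\ \{\!\{\varrho\}\!\}_\gamma\{\!\{v_1\}\!\}\{\!\{v_2\}\!\}\\ \{\!\{\varrho\}\!\}_\gamma\{\!\{v_1\}\!\}\{\!\{v_3\}\!\}\end{bmatrix}.$$ Then $\mathbf f^{*,\mathrm{EC}}$ is consistent, i.e. $\mathbf f^{*,\mathrm{EC}}(\mathbf q,\mathbf q)=\mathbf f(\mathbf q)$ for every state $\mathbf q$, and it is entropy conservative, i.e. for all states $\mathbf u_L,\mathbf u_R$ it satisfies the discrete entropy conservation condition $$[\![\mathbf w]\!]^T\mathbf f^{*,\mathrm{EC}}(\mathbf u_L,\mathbf u_R)=[\![\Psi]\!].$$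
   Context: Equation of state: either the polytropic case, with constants $\gamma>1$, $\kappa>0$, pressure $p(\varrho)=\kappa\varrho^\gamma$ and internal energy $e(\varrho)=\frac{\kappa\varrho^{\gamma-1}}{\gamma-1}$; or the isothermal case, with $\gamma=1$, a constant $c>0$, $p(\varrho)=c^2\varrho$ and $e(\varrho)=c^2\ln(\varrho)$. States have density $\varrho>0$ and velocity $\vec v=(v_1,v_2,v_3)\in\mathbb R^3$. Entropy function: $s(\mathbf u)=\frac{\varrho}{2}\|\vec v\|^2+\varrho e(\varrho)$. Entropy variables: $\mathbf w=\partial s/\partial\mathbf u=\left(e+\frac{p}{\varrho}-\frac12\|\vec v\|^2,\,v_1,\,v_2,\,v_3\right)^T$. Entropy flux: $f^s=v_1(s+p)$. Entropy flux potential: $\Psi=\mathbf w^T\mathbf f-f^s=p\,v_1$. For a quantity with left and right values $(\cdot)_L,(\cdot)_R$, the jump is $[\![\cdot]\!]=(\cdot)_R-(\cdot)_L$ and the arithmetic mean is $\{\!\{\cdot\}\!\}=\frac12\left((\cdot)_L+(\cdot)_R\right)$. The $\gamma$-mean of the density is, for $\varrho_L\neq\varrho_R$, $\{\!\{\varrho\}\!\}_\gamma=\frac1\gamma\frac{[\![p]\!]}{[\![e]\!]}$; for $\varrho_L=\varrho_R=\varrho$ it is given its limiting value $\{\!\{\varrho\}\!\}_\gamma=\varrho$. *)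

theory Defs
  imports "HOL-Analysis.Analysis"
begin

text \<open>\<open>Polytropic \<gamma> \<kappa>\<close> and \<open>Isothermal c\<close>; the admissible
  parameter ranges are imposed by \<open>valid_eos\<close>.\<close>

datatype eos = Polytropic real real | Isothermal real

fun valid_eos :: "eos \<Rightarrow> bool" where
  "valid_eos (Polytropic \<gamma> \<kappa>) \<longleftrightarrow> \<gamma> > 1 \<and> \<kappa> > 0"
| "valid_eos (Isothermal c) \<longleftrightarrow> c > 0"

fun adiabatic_exponent :: "eos \<Rightarrow> real" where
  "adiabatic_exponent (Polytropic \<gamma> \<kappa>) = \<gamma>"
| "adiabatic_exponent (Isothermal c) = 1"

fun pressure :: "eos \<Rightarrow> real \<Rightarrow> real" where
  "pressure (Polytropic \<gamma> \<kappa>) \<rho> = \<kappa> * \<rho> powr \<gamma>"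
| "pressure (Isothermal c) \<rho> = c\<^sup>2 * \<rho>"

fun internal_energy :: "eos \<Rightarrow> real \<Rightarrow> real" where
  "internal_energy (Polytropic \<gamma> \<kappa>) \<rho> = \<kappa> * \<rho> powr (\<gamma> - 1) / (\<gamma> - 1)"
| "internal_energy (Isothermal c) \<rho> = c\<^sup>2 * ln \<rho>"

text \<open>A state is the vector of conserved variables
  \<open>u = (\<rho>, \<rho> v\<^sub>1, \<rho> v\<^sub>2, \<rho> v\<^sub>3)\<close>.\<close>

definition states :: "(real ^ 4) set" where
  "states = {u. u $ 1 > 0}"

definition mass_density :: "real ^ 4 \<Rightarrow> real" where
  "mass_density u = u $ 1"

definition velocity :: "real ^ 4 \<Rightarrow> real ^ 3" where
  "velocity u = vector [u $ 2 / u $ 1, u $ 3 / u $ 1, u $ 4 / u $ 1]"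

definition flux :: "eos \<Rightarrow> real ^ 4 \<Rightarrow> real ^ 4" where
  "flux E u = (let \<rho> = mass_density u; v = velocity u; p = pressure E \<rho> in
     vector [\<rho> * v $ 1, \<rho> * (v $ 1)\<^sup>2 + p, \<rho> * v $ 1 * v $ 2, \<rho> * v $ 1 * v $ 3])"

definition entropy :: "eos \<Rightarrow> real ^ 4 \<Rightarrow> real" where
  "entropy E u = mass_density u / 2 * (norm (velocity u))\<^sup>2 + mass_density u * internal_energy E (mass_density u)"

text \<open>The gradient of the entropy with respect to the conserved variables; it exists on
  \<open>states\<close>, with the usual closed form, by \<open>GDERIV_entropy\<close> and
  \<open>entropy_vars_eq\<close> below.\<close>

definition entropy_vars :: "eos \<Rightarrow> real ^ 4 \<Rightarrow> real ^ 4" where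
  "entropy_vars E u = (THE w. GDERIV (entropy E) u :> w)"

definition entropy_flux :: "eos \<Rightarrow> real ^ 4 \<Rightarrow> real" where
  "entropy_flux E u = velocity u $ 1 * (entropy E u + pressure E (mass_density u))"

definition flux_potential :: "eos \<Rightarrow> real ^ 4 \<Rightarrow> real" where
  "flux_potential E u = entropy_vars E u \<bullet> flux E u - entropy_flux E u"

definition jump :: "('a \<Rightarrow> 'b::real_vector) \<Rightarrow> 'a \<Rightarrow> 'a \<Rightarrow> 'b" where
  "jump q uL uR = q uR - q uL"

definition mean :: "('a \<Rightarrow> real) \<Rightarrow> 'a \<Rightarrow> 'a \<Rightarrow> real" where
  "mean q uL uR = (q uL + q uR) / 2"

text \<open>On the diagonal the quotient is replaced by its limit
  \<open>p'(\<rho>) / (\<gamma> e'(\<rho>)) = \<rho>\<close>.\<close>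

definition gamma_mean :: "eos \<Rightarrow> real ^ 4 \<Rightarrow> real ^ 4 \<Rightarrow> real" where
  "gamma_mean E uL uR =
     (if mass_density uL = mass_density uR then mass_density uL
      else 1 / adiabatic_exponent E *
        (jump (\<lambda>u. pressure E (mass_density u)) uL uR / jump (\<lambda>u. internal_energy E (mass_density u)) uL uR))"

definition flux_EC :: "eos \<Rightarrow> real ^ 4 \<Rightarrow> real ^ 4 \<Rightarrow> real ^ 4" where
  "flux_EC E uL uR =
     (let \<rho> = gamma_mean E uL uR;
          v1 = mean (\<lambda>u. velocity u $ 1) uL uR;
          v2 = mean (\<lambda>u. velocity u $ 2) uL uR;
          v3 = mean (\<lambda>u. velocity u $ 3) uL uR;
          p = mean (\<lambda>u. pressure E (mass_density u)) uL uR
      in vector [\<rho> * v1, \<rho> * v1\<^sup>2 + p, \<rho> * v1 * v2, \<rho> * v1 * v3])"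

lemma vector_4:
  "(vector [a, b, c, d] :: real ^ 4) $ 1 = a"
  "(vector [a, b, c, d] :: real ^ 4) $ 2 = b"
  "(vector [a, b, c, d] :: real ^ 4) $ 3 = c"
  "(vector [a, b, c, d] :: real ^ 4) $ 4 = d"
  unfolding vector_def by simp_all

lemma norm_velocity_sq:
  "(norm (velocity u))\<^sup>2 = ((u $ 2)\<^sup>2 + (u $ 3)\<^sup>2 + (u $ 4)\<^sup>2) / (u $ 1)\<^sup>2"
  unfolding power2_norm_eq_inner inner_vec_def sum_3 velocity_def
  by (simp add: power2_eq_square add_divide_distrib)

lemma entropy_eq:
  assumes "u \<in> states"
  shows "entropy E u =
    ((u $ 2)\<^sup>2 + (u $ 3)\<^sup>2 + (u $ 4)\<^sup>2) / (2 * u $ 1) + u $ 1 * internal_energy E (u $ 1)"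
  unfolding entropy_def norm_velocity_sq using assms
  by (simp add: mass_density_def states_def power2_eq_square)

lemma DERIV_internal_energy:
  assumes "valid_eos E" "\<rho> > 0"
  shows "(internal_energy E has_real_derivative pressure E \<rho> / \<rho>\<^sup>2) (at \<rho>)"
proof (cases E)
  case (Polytropic \<gamma> \<kappa>)
  have "((\<lambda>x. \<kappa> * x powr (\<gamma> - 1) / (\<gamma> - 1)) has_real_derivative
      \<kappa> * \<rho> powr (\<gamma> - 2)) (at \<rho>)"
  proof -
    have "((\<lambda>x. x powr (\<gamma> - 1)) has_real_derivative (\<gamma> - 1) * \<rho> powr (\<gamma> - 1 - 1)) (at \<rho>)"
      using assms(2) by (rule has_real_derivative_powr)
    from DERIV_cmult[OF this, of "\<kappa> / (\<gamma> - 1)"] show ?thesis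
      using assms(1) Polytropic by (simp add: mult.assoc[symmetric])
  qed
  moreover have "\<rho> powr (\<gamma> - 2) = \<rho> powr \<gamma> / \<rho>\<^sup>2"
    using assms by (simp add: powr_diff)
  moreover have "internal_energy E = (\<lambda>x. \<kappa> * x powr (\<gamma> - 1) / (\<gamma> - 1))"
    using Polytropic by auto
  ultimately show ?thesis using Polytropic by simp
next
  case (Isothermal c)
  have "((\<lambda>x. c\<^sup>2 * ln x) has_real_derivative c\<^sup>2 * \<rho> / \<rho>\<^sup>2) (at \<rho>)"
    using assms by (auto intro!: derivative_eq_intros simp: power2_eq_square)
  moreover have "internal_energy E = (\<lambda>x. c\<^sup>2 * ln x)"
    using Isothermal by auto
  ultimately show ?thesis using Isothermal by simp
qed

lemma GDERIV_entropy:
  assumes E: "valid_eos E" and u: "u \<in> states"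
  shows "GDERIV (entropy E) u :> vector
    [internal_energy E (mass_density u) + pressure E (mass_density u) / mass_density u - (norm (velocity u))\<^sup>2 / 2,
     velocity u $ 1, velocity u $ 2, velocity u $ 3]" (is "GDERIV _ _ :> ?w")
proof -
  let ?s = "\<lambda>u :: real ^ 4. ((u $ 2)\<^sup>2 + (u $ 3)\<^sup>2 + (u $ 4)\<^sup>2) / (2 * u $ 1)
    + u $ 1 * internal_energy E (u $ 1)"
  have pos: "u $ 1 > 0" using u by (simp add: states_def)
  have comp: "((\<lambda>u. u $ i) has_derivative (\<lambda>h. h $ i)) (at u)" for i :: 4
    by (rule bounded_linear_imp_has_derivative[OF bounded_linear_vec_nth])
  have e: "((\<lambda>u. internal_energy E (u $ 1)) has_derivative
      (\<lambda>h. pressure E (u $ 1) / (u $ 1)\<^sup>2 * h $ 1)) (at u)"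
    using has_derivative_compose[OF comp
        DERIV_internal_energy[OF E pos, unfolded has_field_derivative_def]] by simp
  have num: "((\<lambda>u. (u $ 2)\<^sup>2 + (u $ 3)\<^sup>2 + (u $ 4)\<^sup>2) has_derivative
      (\<lambda>h. 2 * (u $ 2 * h $ 2 + u $ 3 * h $ 3 + u $ 4 * h $ 4))) (at u)"
    using has_derivative_add[OF has_derivative_add
        [OF has_derivative_power[OF comp[of 2], of 2] has_derivative_power[OF comp[of 3], of 2]]
        has_derivative_power[OF comp[of 4], of 2]]
    by (rule has_derivative_eq_rhs) (simp add: algebra_simps)
  have den: "((\<lambda>u. 2 * u $ 1) has_derivative (\<lambda>h. 2 * h $ 1)) (at u)"
    by (intro has_derivative_mult_right comp)
  have calc: "(2 * (m2 * h2 + m3 * h3 + m4 * h4) * (2 * r) - S * (2 * h1)) / (2 * r * (2 * r))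
        + (r * (P / r\<^sup>2 * h1) + h1 * e)
      = h1 * (e + P / r - S / r\<^sup>2 / 2) + m2 / r * h2 + m3 / r * h3 + m4 / r * h4"
    if "r > 0" for r S P e h1 h2 h3 h4 m2 m3 m4 :: real
  proof -
    have 1: "(2 * M * (2 * r) - S * (2 * h1)) / (2 * r * (2 * r)) = M / r - h1 * (S / r\<^sup>2 / 2)" for M
      using that by (simp add: diff_divide_distrib power2_eq_square ac_simps)
    have 2: "r * (P / r\<^sup>2 * h1) = h1 * (P / r)"
      using that by (simp add: power2_eq_square)
    show ?thesis
      unfolding 1 2 by (simp add: add_divide_distrib right_diff_distrib distrib_left)
  qed
  have inner_w: "h \<bullet> ?w = h $ 1 * (internal_energy E (u $ 1) + pressure E (u $ 1) / u $ 1
      - ((u $ 2)\<^sup>2 + (u $ 3)\<^sup>2 + (u $ 4)\<^sup>2) / (u $ 1)\<^sup>2 / 2)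
      + u $ 2 / u $ 1 * h $ 2 + u $ 3 / u $ 1 * h $ 3 + u $ 4 / u $ 1 * h $ 4" for h
    unfolding inner_vec_def sum_4 vector_4 norm_velocity_sq mass_density_def
    by (simp add: velocity_def mult.commute)
  have "2 * u $ 1 \<noteq> 0" using pos by simp
  from has_derivative_add[OF has_derivative_divide'[OF num den this]
      has_derivative_mult[OF comp[of 1] e]]
  have "(?s has_derivative (\<lambda>h. h \<bullet> ?w)) (at u)"
    unfolding calc[OF pos] inner_w .
  moreover have "open (states :: (real ^ 4) set)"
    unfolding states_def by (intro open_Collect_less continuous_intros)
  ultimately have "(entropy E has_derivative (\<lambda>h. h \<bullet> ?w)) (at u)"
    using u by (rule has_derivative_transform_within_open) (simp add: entropy_eq)
  then show ?thesis by (simp add: gderiv_def)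
qed

lemma entropy_vars_eq:
  assumes "valid_eos E" "u \<in> states"
  shows "entropy_vars E u = vector
    [internal_energy E (mass_density u) + pressure E (mass_density u) / mass_density u - (norm (velocity u))\<^sup>2 / 2,
     velocity u $ 1, velocity u $ 2, velocity u $ 3]"
  unfolding entropy_vars_def
proof (rule the_equality)
  fix w
  assume "GDERIV (entropy E) u :> w"
  then have "(\<lambda>h. h \<bullet> w) = (\<lambda>h. h \<bullet> vector
    [internal_energy E (mass_density u) + pressure E (mass_density u) / mass_density u - (norm (velocity u))\<^sup>2 / 2,
     velocity u $ 1, velocity u $ 2, velocity u $ 3])"
    using GDERIV_entropy[OF assms] unfolding gderiv_def by (rule has_derivative_unique)
  then show "w = vector
    [internal_energy E (mass_density u) + pressure E (mass_density u) / mass_density u - (norm (velocity u))\<^sup>2 / 2,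
     velocity u $ 1, velocity u $ 2, velocity u $ 3]"
    by - (rule vector_eq_ldot[THEN iffD1], rule allI, erule fun_cong)
qed (rule GDERIV_entropy[OF assms])

lemma flux_potential_eq:
  assumes "valid_eos E" "u \<in> states"
  shows "flux_potential E u = pressure E (mass_density u) * velocity u $ 1"
proof -
  have pos: "mass_density u > 0" using assms by (simp add: states_def mass_density_def)
  have n: "(norm (velocity u))\<^sup>2 = (velocity u $ 1)\<^sup>2 + (velocity u $ 2)\<^sup>2 + (velocity u $ 3)\<^sup>2"
    unfolding power2_norm_eq_inner inner_vec_def sum_3 by (simp add: power2_eq_square)
  have calc: "(e + p / r - (a\<^sup>2 + b\<^sup>2 + c\<^sup>2) / 2) * (r * a) + a * (r * a\<^sup>2 + p) + b * (r * a * b)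
      + c * (r * a * c) - a * (r / 2 * (a\<^sup>2 + b\<^sup>2 + c\<^sup>2) + r * e + p) = p * a"
    if "r > 0" for r e p a b c :: real
  proof -
    have "p / r * (r * a) = p * a" using that by simp
    then show ?thesis unfolding distrib_right left_diff_distrib
      by (simp add: algebra_simps power2_eq_square)
  qed
  show ?thesis
    unfolding flux_potential_def entropy_vars_eq[OF assms] flux_def entropy_flux_def entropy_def
      n Let_def inner_vec_def sum_4 vector_4 inner_real_def
    by (rule calc[OF pos])
qed

end

theory Submission
  imports Defs
begin

text \<open>The specific enthalpy \<open>e + p / \<rho>\<close> differs from \<open>\<gamma> e\<close> only by a constant, so
  \<open>\<lbrakk>e + p / \<rho>\<rbrakk> {\<rho>}\<^sub>\<gamma> = \<lbrakk>p\<rbrakk>\<close>: the \<open>\<gamma>\<close>-mean is chosen for exactly this. In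
  \<open>\<lbrakk>w\<rbrakk> \<bullet> f\<close> the kinetic terms cancel because \<open>\<lbrakk>a\<^sup>2\<rbrakk> = 2 {a} \<lbrakk>a\<rbrakk>\<close>, and what remains is
  \<open>\<lbrakk>p\<rbrakk> {v\<^sub>1} + {p} \<lbrakk>v\<^sub>1\<rbrakk> = \<lbrakk>p v\<^sub>1\<rbrakk>\<close>.\<close>

lemma internal_energy_strict_mono:
  assumes "valid_eos E" "0 < x" "x < y"
  shows "internal_energy E x < internal_energy E y"
  using assms
  by (cases E) (auto intro!: divide_strict_right_mono mult_strict_left_mono powr_less_mono2)

text \<open>Keeps the denominator of the quotient in \<open>gamma_mean\<close> away from zero when
  the densities differ.\<close>

lemma internal_energy_eq_iff:
  assumes "valid_eos E" "0 < x" "0 < y"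
  shows "internal_energy E x = internal_energy E y \<longleftrightarrow> x = y"
  using assms internal_energy_strict_mono[of E x y] internal_energy_strict_mono[of E y x]
  by (cases x y rule: linorder_cases) auto

text \<open>Stated for differences because in the isothermal case \<open>e + p / \<rho>\<close> is
  \<open>e + c\<^sup>2\<close>, and the constant cancels only in the jump.\<close>

lemma enthalpy_diff:
  assumes "valid_eos E" "0 < x" "0 < y"
  shows "(internal_energy E y + pressure E y / y) - (internal_energy E x + pressure E x / x)
    = adiabatic_exponent E * (internal_energy E y - internal_energy E x)"
proof (cases E)
  case (Polytropic \<gamma> \<kappa>)
  have "internal_energy E z + pressure E z / z = \<gamma> * internal_energy E z" if "z > 0" for z
  proof -
    \<comment> \<open>The right-hand side is \<open>(\<gamma> - 1) * e\<close>; adding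
      \<open>e\<close> gives the factor \<open>\<gamma>\<close>.\<close>
    have "pressure E z / z = \<kappa> * z powr (\<gamma> - 1)"
      using that Polytropic by (simp add: powr_diff)
    then show ?thesis
      using assms(1) Polytropic by (simp add: field_simps)
  qed
  then show ?thesis
    using assms Polytropic by (simp add: right_diff_distrib)
next
  case (Isothermal c)
  then show ?thesis using assms by simp
qed

lemma enthalpy_diff_gamma_mean:
  assumes E: "valid_eos E" and "uL \<in> states" "uR \<in> states"
  defines "\<rho>L \<equiv> mass_density uL" and "\<rho>R \<equiv> mass_density uR"
  shows "((internal_energy E \<rho>R + pressure E \<rho>R / \<rho>R) - (internal_energy E \<rho>L + pressure E \<rho>L / \<rho>L))
    * gamma_mean E uL uR = pressure E \<rho>R - pressure E \<rho>L"
proof (cases "\<rho>L = \<rho>R")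
  case True
  \<comment> \<open>Equal densities make both jumps vanish.\<close>
  then show ?thesis by simp
next
  case False
  have pos: "\<rho>L > 0" "\<rho>R > 0"
    using assms by (simp_all add: states_def mass_density_def)
  have "internal_energy E \<rho>R - internal_energy E \<rho>L \<noteq> 0"
    using internal_energy_eq_iff[OF E pos] False by simp
  moreover have "adiabatic_exponent E \<noteq> 0"
    using E by (cases E) auto
  ultimately show ?thesis
    using False unfolding enthalpy_diff[OF E pos]
    by (simp add: gamma_mean_def jump_def \<rho>L_def \<rho>R_def)
qed

text \<open>Equal densities select the diagonal branch of \<open>gamma_mean\<close>, and arithmetic
  means of equal values are trivial.\<close>

lemma flux_EC_consistent: "flux_EC E q q = flux E q"
  by (simp add: flux_EC_def flux_def gamma_mean_def mean_def Let_def)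

lemma flux_EC_entropy_conservative:
  assumes E: "valid_eos E" and L: "uL \<in> states" and R: "uR \<in> states"
  shows "jump (entropy_vars E) uL uR \<bullet> flux_EC E uL uR = jump (flux_potential E) uL uR"
proof -
  have norm_sq: "(norm (velocity u))\<^sup>2
      = (velocity u $ 1)\<^sup>2 + (velocity u $ 2)\<^sup>2 + (velocity u $ 3)\<^sup>2" for u
    unfolding power2_norm_eq_inner inner_vec_def sum_3 by (simp add: power2_eq_square)
  \<comment> \<open>The claim as an identity in real variables: \<open>h\<close> stands for
    \<open>e + p / \<rho>\<close>, \<open>g\<close> for the \<open>\<gamma>\<close>-mean and
    \<open>a\<close>, \<open>b\<close>, \<open>c\<close> for the velocity components. The equation
    of state enters only through the premise.\<close>
  have calc: "((hR - (aR\<^sup>2 + bR\<^sup>2 + cR\<^sup>2) / 2) - (hL - (aL\<^sup>2 + bL\<^sup>2 + cL\<^sup>2) / 2)) * (g * ((aL + aR) / 2))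
      + (aR - aL) * (g * ((aL + aR) / 2)\<^sup>2 + (pL + pR) / 2)
      + (bR - bL) * (g * ((aL + aR) / 2) * ((bL + bR) / 2))
      + (cR - cL) * (g * ((aL + aR) / 2) * ((cL + cR) / 2)) = pR * aR - pL * aL" (is "?lhs = _")
    if "(hR - hL) * g = pR - pL" for hL hR aL aR bL bR cL cR pL pR g :: real
  proof -
    have "?lhs = (hR - hL) * g * ((aL + aR) / 2) + (aR - aL) * ((pL + pR) / 2)"
      by (simp add: field_simps power2_eq_square)
    also have "\<dots> = pR * aR - pL * aL"
      unfolding that by (simp add: field_simps)
    finally show ?thesis .
  qed
  show ?thesis
    unfolding jump_def entropy_vars_eq[OF E L] entropy_vars_eq[OF E R]
      flux_potential_eq[OF E L] flux_potential_eq[OF E R] flux_EC_def Let_def mean_def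
      inner_vec_def sum_4 vector_minus_component vector_4 inner_real_def norm_sq
    by (rule calc[OF enthalpy_diff_gamma_mean[OF E L R]])
qed

theorem theorem1:
  fixes E :: eos
  assumes "valid_eos E"
  shows "(\<forall>q\<in>states. flux_EC E q q = flux E q) \<and>
    (\<forall>uL\<in>states. \<forall>uR\<in>states.
      jump (entropy_vars E) uL uR \<bullet> flux_EC E uL uR = jump (flux_potential E) uL uR)"
  using flux_EC_consistent flux_EC_entropy_conservative[OF assms] by blast

end
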